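(* Let $F\subset\mathbb{R}^2$ be an arbitrary non-empty compact set and let $W\in\mathbb{RP}^1$ be arbitrary. Then there exist a weak tangent $E\in\operatorname{Tan}(F)$ and a point $x\in\pi_W(E)$ such that $$\dim_{\mathrm H}\bigl(\pi_W^{-1}(x)\cap E\bigr)\geq \max\{\dim_{\mathrm A}F-\dim_{\mathrm A}\pi_W(F),\,0\}.$$
   Context: $\mathbb{RP}^1$ is the set of one-dimensional linear subspaces of $\mathbb{R}^2$, and for $W\in\mathbb{RP}^1$, $\pi_W\colon\mathbb{R}^2\to W$ is the orthogonal projection onto $W$. $B(x,r)$ denotes the closed ball. $\dim_{\mathrm H}$ is Hausdorff dimension. The Assouad dimension of a bounded set $F\subset\mathbb{R}^d$ is $$\dim_{\mathrm A}F=\inf\Bigl\{s\ge 0:\exists C>0\ \forall\,0<r\le R\le 1\ \forall x\in F,\ N_r(F\cap B(x,R))\le C\bigl(\tfrac{R}{r}\bigr)^s\Bigr\},$$ where $N_r(E)$ is the smallest number of open balls of radius $r$ needed to cover $E$. A weak tangent of a compact set $F\subset\mathbb{R}^d$ is a non-empty compact set $E\subset B(0,1)$ for which there are points $x_n\in F$ and scales $0<r_n\le 1$ with $r_n\to0$ such that $E=\lim_{n\to\infty}r_n^{-1}(F-x_n)\cap B(0,1)$ in the Hausdorff metric (no rotations are allowed). $\operatorname{Tan}(F)$ is the set of all weak tangents of $F$. *)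

theory Defs
  imports "HOL-Analysis.Analysis"
begin

definition orth_proj :: "'a::euclidean_space set \<Rightarrow> 'a \<Rightarrow> 'a" where
  "orth_proj W v = (THE p. p \<in> W \<and> (\<forall>w\<in>W. orthogonal (v - p) w))"

text \<open>The real-valued infima below are meaningful because the sets involved are non-empty in
  Euclidean space (every \<open>s > DIM('a)\<close> belongs to them) and bounded below by 0.\<close>

text \<open>The centres of the balls need not lie in \<open>E\<close>. A finite cover exists whenever \<open>E\<close> is bounded
  and \<open>r > 0\<close>.\<close>

definition covering_number :: "real \<Rightarrow> 'a::euclidean_space set \<Rightarrow> nat" where
  "covering_number r E = (LEAST n. \<exists>T. finite T \<and> card T = n \<and> E \<subseteq> (\<Union>c\<in>T. ball c r))"

definition assouad_dim :: "'a::euclidean_space set \<Rightarrow> real" where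
  "assouad_dim F = Inf {s. 0 \<le> s \<and> (\<exists>C>0. \<forall>r R. 0 < r \<longrightarrow> r \<le> R \<longrightarrow> R \<le> 1 \<longrightarrow>
      (\<forall>x\<in>F. real (covering_number r (F \<inter> cball x R)) \<le> C * (R / r) powr s))}"

text \<open>The case distinction implements the usual conventions that \<open>diameter U\<close> to the power 0
  is 1 for non-empty \<open>U\<close> (note \<open>0 powr 0 = 0\<close>) and that the empty set contributes 0.\<close>

definition diam_pow :: "real \<Rightarrow> 'a::euclidean_space set \<Rightarrow> ennreal" where
  "diam_pow s U = (if U = {} then 0 else if s = 0 then 1 else ennreal (diameter U powr s))"

text \<open>Boundedness is required explicitly since \<open>diameter\<close> is unspecified on unbounded sets.\<close>

definition hausdorff_premeasure :: "real \<Rightarrow> real \<Rightarrow> 'a::euclidean_space set \<Rightarrow> ennreal" where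
  "hausdorff_premeasure s \<delta> E =
    (INF U\<in>{U :: nat \<Rightarrow> 'a set. E \<subseteq> (\<Union>i. U i) \<and> (\<forall>i. bounded (U i) \<and> diameter (U i) \<le> \<delta>)}.
      (\<Sum>i. diam_pow s (U i)))"

definition hausdorff_measure :: "real \<Rightarrow> 'a::euclidean_space set \<Rightarrow> ennreal" where
  "hausdorff_measure s E = (SUP \<delta>\<in>{0<..}. hausdorff_premeasure s \<delta> E)"

definition hausdorff_dim :: "'a::euclidean_space set \<Rightarrow> real" where
  "hausdorff_dim E = Inf {s. 0 \<le> s \<and> hausdorff_measure s E = 0}"

text \<open>Used only for non-empty bounded sets, where the suprema are finite.\<close>

definition hausdorff_dist :: "'a::metric_space set \<Rightarrow> 'a set \<Rightarrow> real" where
  "hausdorff_dist A B = max (SUP a\<in>A. infdist a B) (SUP b\<in>B. infdist b A)"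

definition weak_tangents :: "'a::euclidean_space set \<Rightarrow> 'a set set" where
  "weak_tangents F = {E. E \<noteq> {} \<and> compact E \<and> E \<subseteq> cball 0 1 \<and>
     (\<exists>(x :: nat \<Rightarrow> 'a) (r :: nat \<Rightarrow> real).
        (\<forall>n. x n \<in> F) \<and> (\<forall>n. 0 < r n \<and> r n \<le> 1) \<and> r \<longlonglongrightarrow> 0 \<and>
        (\<lambda>n. hausdorff_dist ((\<lambda>y. inverse (r n) *\<^sub>R (y - x n)) ` F \<inter> cball 0 1) E) \<longlonglongrightarrow> 0)}"

end

theory Submission
  imports Defs "HOL-Complex_Analysis.Great_Picard"
begin

text \<open>
  Let \<open>P\<close> be the projection and \<open>d = assouad_dim F - assouad_dim (P ` F)\<close>. If \<open>d \<le> 0\<close>, any tangent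
  containing 0 works, so let \<open>d > 0\<close> and \<open>0 \<le> a < d\<close>.

  Choose \<open>t > assouad_dim (P ` F)\<close> with \<open>t + a < assouad_dim F\<close>. Some ball of radius \<open>R\<close> needs many
  more than \<open>(R/r) powr (t + a)\<close> balls of radius \<open>r\<close> to cover its part of \<open>F\<close>, while the projection of
  this part is covered by \<open>(R/r) powr t\<close> balls up to a constant factor. By the pigeonhole principle some tube of width \<open>r\<close> over a
  ball in the image contains a part \<open>T\<close> of \<open>F\<close> whose covering number at scale \<open>r\<close> is much larger than
  \<open>(R/r) powr a\<close> (\<open>tube_with_large_covering_number\<close>). Although this concerns only one pair of scales,
  passing to the smallest scale \<open>\<rho>\<close> at which some ball of \<open>T\<close> is still that rich yields a
  Frostman condition on all scales \<open>\<sigma>\<close> between \<open>r\<close> and \<open>\<rho> / 2\<close>: a ball of radius \<open>\<sigma>\<close> carries at most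
  the proportion \<open>(2 \<sigma> / \<rho>) powr a\<close> of the covering number of the rich ball
  (\<open>ball_with_frostman_growth\<close>). Both \<open>\<rho>\<close> and \<open>r / \<rho>\<close> can be made arbitrarily small.

  Let \<open>a\<close> tend to \<open>d\<close>, and let \<open>E\<close> be a limit of the magnifications of \<open>F\<close> by \<open>1 / \<rho>\<close> at the centres of
  the rich balls (\<open>weak_tangent_subsequence\<close>). The magnified tubes have width about \<open>r / \<rho>\<close>, so their
  limit points lie in the fibre of \<open>E\<close> over 0. If this fibre were null in a dimension \<open>s < d\<close>, finitely
  many open balls of small total \<open>s\<close>-cost would cover it, hence would cover a magnified tube,
  contradicting the Frostman condition by subadditivity of covering numbers
  (\<open>frostman_growth_imp_covering_cost_ge_1\<close>). Thus the fibre over 0 has dimension at least \<open>d\<close>, and the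
  bound is attained by one tangent because the exponents vary along the sequence.

  The argument applies to every linear contraction of a Euclidean space
  (\<open>tangent_with_large_fibre\<close>).
\<close>

section \<open>Covering numbers\<close>

lemma covering_number_le:
  assumes "finite T" "E \<subseteq> (\<Union>c\<in>T. ball c r)"
  shows "covering_number r E \<le> card T"
  unfolding covering_number_def using assms by (intro Least_le) blast

lemma covering_number_attained:
  fixes E :: "'a::euclidean_space set"
  assumes "bounded E" "0 < r"
  obtains T where "finite T" "card T = covering_number r E" "E \<subseteq> (\<Union>c\<in>T. ball c r)"
proof -
  have "compact (closure E)"
    using assms by (simp add: compact_closure)
  then obtain T where "finite T" "closure E \<subseteq> (\<Union>c\<in>T. ball c r)"
    using \<open>0 < r\<close> unfolding compact_eq_totally_bounded by blast
  then have "\<exists>n T. finite T \<and> card T = n \<and> E \<subseteq> (\<Union>c\<in>T. ball c r)"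
    using closure_subset[of E] by blast
  then have "\<exists>T. finite T \<and> card T = covering_number r E \<and> E \<subseteq> (\<Union>c\<in>T. ball c r)"
    unfolding covering_number_def by (rule LeastI_ex)
  then show thesis using that by blast
qed

lemma covering_number_mono:
  fixes E :: "'a::euclidean_space set"
  assumes "bounded E'" "0 < r" "E \<subseteq> E'"
  shows "covering_number r E \<le> covering_number r E'"
proof -
  obtain T where "finite T" "card T = covering_number r E'" "E' \<subseteq> (\<Union>c\<in>T. ball c r)"
    using covering_number_attained[OF assms(1,2)] .
  then show ?thesis
    using covering_number_le[of T E r] assms(3) by auto
qed

lemma covering_number_empty [simp]: "covering_number r {} = 0"
  using covering_number_le[of "{}" "{}" r] by simp

lemma covering_number_pos:
  fixes E :: "'a::euclidean_space set"
  assumes "bounded E" "0 < r" "E \<noteq> {}"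
  shows "0 < covering_number r E"
proof -
  obtain T where "finite T" "card T = covering_number r E" "E \<subseteq> (\<Union>c\<in>T. ball c r)"
    using covering_number_attained[OF assms(1,2)] .
  then show ?thesis
    using assms(3) by (metis UN_empty card_gt_0_iff subset_empty)
qed

lemma covering_number_UN_le:
  fixes E :: "'a::euclidean_space set"
  assumes "bounded E" "0 < r" "finite I" "E \<subseteq> (\<Union>i\<in>I. A i)"
  shows "covering_number r E \<le> (\<Sum>i\<in>I. covering_number r (E \<inter> A i))"
proof -
  have "\<exists>T. finite T \<and> card T = covering_number r (E \<inter> A i) \<and> E \<inter> A i \<subseteq> (\<Union>c\<in>T. ball c r)" for i
    using covering_number_attained[of "E \<inter> A i" r] assms(1,2) bounded_Int by metis
  then obtain T where T: "\<And>i. finite (T i)" "\<And>i. card (T i) = covering_number r (E \<inter> A i)"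
      "\<And>i. E \<inter> A i \<subseteq> (\<Union>c\<in>T i. ball c r)"
    by metis
  have "E \<subseteq> (\<Union>c\<in>(\<Union>i\<in>I. T i). ball c r)"
  proof
    fix x assume "x \<in> E"
    then obtain i where "i \<in> I" "x \<in> E \<inter> A i" using assms(4) by blast
    then show "x \<in> (\<Union>c\<in>(\<Union>i\<in>I. T i). ball c r)" using T(3)[of i] by blast
  qed
  then have "covering_number r E \<le> card (\<Union>i\<in>I. T i)"
    using T(1) assms(3) by (intro covering_number_le) auto
  also have "\<dots> \<le> (\<Sum>i\<in>I. card (T i))"
    by (rule card_UN_le[OF assms(3)])
  finally show ?thesis by (simp add: T(2))
qed

lemma covering_number_pigeonhole:
  fixes E :: "'a::euclidean_space set"
  assumes "bounded E" "0 < r" "finite I" "E \<subseteq> (\<Union>i\<in>I. A i)"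
    and "real (card I) \<le> D" "0 \<le> X" "X * D < real (covering_number r E)"
  shows "\<exists>i\<in>I. X < real (covering_number r (E \<inter> A i))"
proof (rule ccontr)
  assume "\<not> ?thesis"
  then have "(\<Sum>i\<in>I. real (covering_number r (E \<inter> A i))) \<le> (\<Sum>i\<in>I. X)"
    by (intro sum_mono) force
  moreover have "real (covering_number r E) \<le> (\<Sum>i\<in>I. real (covering_number r (E \<inter> A i)))"
    using of_nat_mono[OF covering_number_UN_le[OF assms(1-4)]] by simp
  moreover have "X * real (card I) \<le> X * D"
    using assms(5,6) by (rule mult_left_mono)
  ultimately show False
    using assms(7) by (simp add: mult.commute)
qed

lemma power_of_two_bracket:
  fixes x :: real
  assumes "1 \<le> x"
  obtains j where "2 ^ j \<le> x" "x < 2 ^ Suc j"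
proof -
  define k where "k = (LEAST k. x < 2 ^ k)"
  have k: "x < 2 ^ k"
    unfolding k_def by (rule LeastI_ex) (simp add: real_arch_pow)
  have "k \<noteq> 0" using k assms by (intro notI) simp
  then obtain j where j: "k = Suc j" using not0_implies_Suc by blast
  then have "\<not> x < 2 ^ j" using not_less_Least[of j "\<lambda>k. x < 2 ^ k"] k_def by simp
  then show thesis using that[of j] k j by simp
qed

text \<open>The proof halves radii repeatedly: if \<open>q\<close> balls of radius \<open>1/2\<close> cover the unit ball, then \<open>q ^ k\<close>
  balls of radius \<open>\<rho> / 2 ^ k\<close> cover a ball of radius \<open>\<rho>\<close>. The exponent is crude; polynomial growth
  as such makes the Assouad and Hausdorff dimensions genuine infima, and it turns a large covering
  number into a large ratio of scales.\<close>

lemma covering_number_cball_polynomial: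
  "\<exists>q>0. \<forall>(E::'a::euclidean_space set) y r \<rho>.
      0 < r \<longrightarrow> r \<le> \<rho> \<longrightarrow> E \<subseteq> cball y \<rho> \<longrightarrow> real (covering_number r E) \<le> (2 * \<rho> / r) ^ q"
proof -
  obtain S :: "'a set" where S: "finite S" "cball 0 1 \<subseteq> (\<Union>c\<in>S. ball c (1/2))"
    using compact_cball[of "0::'a" 1] unfolding compact_eq_totally_bounded
    by (auto dest: spec[of _ "1/2"])
  define q where "q = card S"
  have "S \<noteq> {}" using S(2) by auto
  then have "0 < q" using S(1) by (simp add: q_def card_gt_0_iff)
  \<comment> \<open>Closed balls, as the open ball of radius \<open>\<rho>\<close> does not cover the closed one when \<open>k = 0\<close>.\<close>
  have halve: "\<exists>T. finite T \<and> card T \<le> q ^ k \<and> cball y \<rho> \<subseteq> (\<Union>c\<in>T. cball c (\<rho> / 2 ^ k))"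
    if "0 < \<rho>" for y :: 'a and \<rho> k
  proof (induction k)
    case 0
    show ?case by (intro exI[of _ "{y}"]) simp
  next
    case (Suc k)
    then obtain T where T: "finite T" "card T \<le> q ^ k" "cball y \<rho> \<subseteq> (\<Union>c\<in>T. cball c (\<rho> / 2 ^ k))"
      by blast
    define \<sigma> where "\<sigma> = \<rho> / 2 ^ k"
    define T' where "T' = (\<lambda>(c, v). c + \<sigma> *\<^sub>R v) ` (T \<times> S)"
    have pos: "0 < \<sigma>" using that by (simp add: \<sigma>_def)
    have "cball y \<rho> \<subseteq> (\<Union>c\<in>T'. cball c (\<rho> / 2 ^ Suc k))"
    proof
      fix x assume "x \<in> cball y \<rho>"
      then obtain c where c: "c \<in> T" "dist c x \<le> \<sigma>"
        using T(3) unfolding \<sigma>_def by (meson UN_E in_mono mem_cball)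
      define w where "w = inverse \<sigma> *\<^sub>R (x - c)"
      have xw: "x - c = \<sigma> *\<^sub>R w" using pos by (simp add: w_def)
      have "norm w = dist c x / \<sigma>"
        unfolding w_def dist_norm norm_minus_commute[of c x] using pos by (simp add: divide_simps)
      then have "norm w \<le> 1" using pos c(2) by simp
      then have "w \<in> cball 0 1" by simp
      then have "w \<in> (\<Union>c\<in>S. ball c (1/2))" using S(2) by blast
      then obtain v where v: "v \<in> S" "dist v w < 1/2" by (metis UN_E mem_ball)
      have "dist (c + \<sigma> *\<^sub>R v) x = norm (\<sigma> *\<^sub>R (v - w))"
        using xw by (simp add: dist_norm algebra_simps)
      also have "\<dots> = \<sigma> * dist v w"
        using pos by (simp add: dist_norm)
      also have "\<dots> \<le> \<sigma> * (1/2)" using v(2) pos by (intro mult_left_mono) auto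
      finally have "dist (c + \<sigma> *\<^sub>R v) x \<le> \<rho> / 2 ^ Suc k" by (simp add: \<sigma>_def)
      moreover have "c + \<sigma> *\<^sub>R v \<in> T'" using c(1) v(1) by (force simp: T'_def)
      ultimately show "x \<in> (\<Union>c\<in>T'. cball c (\<rho> / 2 ^ Suc k))" by (meson UN_I mem_cball)
    qed
    moreover have "card T' \<le> q ^ Suc k"
    proof -
      have "card T' \<le> card (T \<times> S)" unfolding T'_def using T(1) S(1) by (intro card_image_le) auto
      also have "\<dots> \<le> q ^ k * q" using T(2) by (simp add: card_cartesian_product q_def)
      finally show ?thesis by (simp add: mult.commute)
    qed
    ultimately show ?case using T(1) S(1) by (intro exI[of _ T']) (auto simp: T'_def)
  qed
  have "real (covering_number r E) \<le> (2 * \<rho> / r) ^ q"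
    if r: "0 < r" "r \<le> \<rho>" and E: "E \<subseteq> cball y \<rho>" for E :: "'a set" and y r \<rho>
  proof -
    have \<rho>: "0 < \<rho>" using r by linarith
    have "1 \<le> \<rho> / r" using r by simp
    then obtain l where l: "2 ^ l \<le> \<rho> / r" "\<rho> / r < 2 ^ Suc l"
      by (rule power_of_two_bracket)
    define k where "k = Suc l"
    have k: "\<rho> / r < 2 ^ k" and kle: "2 ^ k \<le> 2 * \<rho> / r" using l by (simp_all add: k_def)
    obtain T where T: "finite T" "card T \<le> q ^ k" "cball y \<rho> \<subseteq> (\<Union>c\<in>T. cball c (\<rho> / 2 ^ k))"
      using halve[OF \<rho>] by blast
    have "\<rho> / 2 ^ k < r" using k r by (simp add: field_simps)
    then have "cball c (\<rho> / 2 ^ k) \<subseteq> ball c r" for c :: 'a by auto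
    then have "E \<subseteq> (\<Union>c\<in>T. ball c r)" using E T(3) by blast
    then have "covering_number r E \<le> q ^ k"
      using covering_number_le[OF T(1)] T(2) by (meson order_trans)
    \<comment> \<open>Trading the base \<open>q\<close> for \<open>2 ^ q\<close> makes the count a power of the dyadic scale.\<close>
    also have "\<dots> \<le> (2 ^ q) ^ k" by (intro power_mono) (auto simp: less_imp_le)
    finally have "real (covering_number r E) \<le> (2 ^ k) ^ q"
      by (metis of_nat_le_iff of_nat_numeral of_nat_power power_commutes power_mult mult.commute)
    also have "\<dots> \<le> (2 * \<rho> / r) ^ q" using kle by (intro power_mono) auto
    finally show ?thesis .
  qed
  with \<open>0 < q\<close> show ?thesis by blast
qed

section \<open>The Assouad dimension\<close>

lemma bdd_below_nonneg: "bdd_below {s::real. 0 \<le> s \<and> Q s}"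
  by (rule bdd_belowI[of _ 0]) auto

lemma less_assouad_dim_imp_exceeds:
  fixes F :: "'a::euclidean_space set"
  assumes "0 \<le> s" "s < assouad_dim F" "0 < C"
  obtains r R x where "0 < r" "r \<le> R" "R \<le> 1" "x \<in> F"
    "C * (R / r) powr s < real (covering_number r (F \<inter> cball x R))"
proof -
  have "\<not> (\<exists>C>0. \<forall>r R. 0 < r \<longrightarrow> r \<le> R \<longrightarrow> R \<le> 1 \<longrightarrow>
      (\<forall>x\<in>F. real (covering_number r (F \<inter> cball x R)) \<le> C * (R / r) powr s))"
  proof
    assume "\<exists>C>0. \<forall>r R. 0 < r \<longrightarrow> r \<le> R \<longrightarrow> R \<le> 1 \<longrightarrow>
      (\<forall>x\<in>F. real (covering_number r (F \<inter> cball x R)) \<le> C * (R / r) powr s)"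
    then have "assouad_dim F \<le> s"
      unfolding assouad_dim_def using assms(1) by (intro cInf_lower bdd_below_nonneg) simp
    then show False using assms(2) by simp
  qed
  then show thesis using assms(3) that by (meson not_le)
qed

lemma assouad_dim_set_nonempty:
  fixes F :: "'a::euclidean_space set"
  shows "{s. 0 \<le> s \<and> (\<exists>C>0. \<forall>r R. 0 < r \<longrightarrow> r \<le> R \<longrightarrow> R \<le> 1 \<longrightarrow>
      (\<forall>x\<in>F. real (covering_number r (F \<inter> cball x R)) \<le> C * (R / r) powr s))} \<noteq> {}"
proof -
  obtain q :: nat where "0 < q" and q: "\<And>(E::'a set) y r \<rho>.
      0 < r \<Longrightarrow> r \<le> \<rho> \<Longrightarrow> E \<subseteq> cball y \<rho> \<Longrightarrow> real (covering_number r E) \<le> (2 * \<rho> / r) ^ q"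
    using covering_number_cball_polynomial[where 'a = 'a] by blast
  have "\<forall>r R. 0 < r \<longrightarrow> r \<le> R \<longrightarrow> R \<le> 1 \<longrightarrow>
      (\<forall>x\<in>F. real (covering_number r (F \<inter> cball x R)) \<le> 2 ^ q * (R / r) powr real q)"
  proof (intro allI impI ballI)
    fix r R :: real and x
    assume that: "0 < r" "r \<le> R"
    show "real (covering_number r (F \<inter> cball x R)) \<le> 2 ^ q * (R / r) powr real q"
      using q[OF that, of "F \<inter> cball x R" x] that
      by (simp add: powr_realpow power_mult_distrib[symmetric])
  qed
  then have "real q \<in> {s. 0 \<le> s \<and> (\<exists>C>0. \<forall>r R. 0 < r \<longrightarrow> r \<le> R \<longrightarrow> R \<le> 1 \<longrightarrow>
      (\<forall>x\<in>F. real (covering_number r (F \<inter> cball x R)) \<le> C * (R / r) powr s))}"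
    by (intro CollectI conjI exI[of _ "2 ^ q"]) auto
  then show ?thesis by blast
qed

lemma assouad_dim_nonneg:
  fixes F :: "'a::euclidean_space set"
  shows "0 \<le> assouad_dim F"
  unfolding assouad_dim_def by (rule cInf_greatest[OF assouad_dim_set_nonempty]) auto

lemma assouad_dim_less_imp_bounded:
  fixes F :: "'a::euclidean_space set"
  assumes "assouad_dim F < t"
  obtains C where "0 < C" "\<And>r R x. 0 < r \<Longrightarrow> r \<le> R \<Longrightarrow> R \<le> 1 \<Longrightarrow> x \<in> F \<Longrightarrow>
      real (covering_number r (F \<inter> cball x R)) \<le> C * (R / r) powr t"
proof -
  obtain s C where s: "0 \<le> s" "s < t" "0 < C" and C: "\<And>r R x. 0 < r \<Longrightarrow> r \<le> R \<Longrightarrow> R \<le> 1 \<Longrightarrow> x \<in> F \<Longrightarrow>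
      real (covering_number r (F \<inter> cball x R)) \<le> C * (R / r) powr s"
    using cInf_lessD[OF assouad_dim_set_nonempty assms[unfolded assouad_dim_def]] by blast
  have "real (covering_number r (F \<inter> cball x R)) \<le> C * (R / r) powr t"
    if "0 < r" "r \<le> R" "R \<le> 1" "x \<in> F" for r R x
  proof -
    have "C * (R / r) powr s \<le> C * (R / r) powr t"
      using s that by (intro mult_left_mono powr_mono) auto
    then show ?thesis using C[OF that] by linarith
  qed
  then show thesis using that s(3) by blast
qed

text \<open>The two Assouad dimensions meet here, on a single pair of scales. Choose \<open>t\<close> above the dimension of
  the projection with \<open>t + a\<close> still below that of \<open>F\<close>. Some ball \<open>cball x R\<close> needs more than
  \<open>M C (R/r) powr (t + a)\<close> balls of radius \<open>r\<close>, while its image lies in at most \<open>C (R/r) powr t\<close>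
  balls of radius \<open>r\<close>. By the pigeonhole principle the part above one of these is large.\<close>

lemma tube_with_large_covering_number:
  fixes F :: "'a::euclidean_space set" and P :: "'a \<Rightarrow> 'a"
  assumes "compact F" "linear P" "\<And>v. norm (P v) \<le> norm v"
    and "0 \<le> a" "a < assouad_dim F - assouad_dim (P ` F)" "0 < M"
  obtains r R x c where "0 < r" "r \<le> R" "R \<le> 1" "x \<in> F"
    "M * (R / r) powr a < real (covering_number r ((F \<inter> cball x R) \<inter> P -` ball c r))"
proof -
  \<comment> \<open>Half of the gap \<open>assouad_dim F - assouad_dim (P ` F) - a\<close> is given away on either side.\<close>
  define t where "t = (assouad_dim F - a + assouad_dim (P ` F)) / 2"
  have t: "assouad_dim (P ` F) < t" "t + a < assouad_dim F"
    using assms(5) by (auto simp: t_def field_simps)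
  have "0 \<le> t" using t(1) assouad_dim_nonneg[of "P ` F"] by linarith
  obtain C where C: "0 < C" "\<And>r R x. 0 < r \<Longrightarrow> r \<le> R \<Longrightarrow> R \<le> 1 \<Longrightarrow> x \<in> P ` F \<Longrightarrow>
      real (covering_number r (P ` F \<inter> cball x R)) \<le> C * (R / r) powr t"
    using assouad_dim_less_imp_bounded[OF t(1)] by blast
  obtain r R x where r: "0 < r" "r \<le> R" "R \<le> 1" "x \<in> F"
    and big: "M * C * (R / r) powr (t + a) < real (covering_number r (F \<inter> cball x R))"
    using less_assouad_dim_imp_exceeds[of "t + a" F "M * C"] t \<open>0 \<le> t\<close> assms(4,6) C(1)
    by (metis add_nonneg_nonneg mult_pos_pos)
  have bP: "bounded (P ` F \<inter> cball (P x) R)" by (simp add: bounded_Int)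
  obtain I where I: "finite I" "card I = covering_number r (P ` F \<inter> cball (P x) R)"
      "P ` F \<inter> cball (P x) R \<subseteq> (\<Union>c\<in>I. ball c r)"
    using covering_number_attained[OF bP r(1)] .
  have "\<exists>c\<in>I. M * (R / r) powr a < real (covering_number r ((F \<inter> cball x R) \<inter> P -` ball c r))"
  proof (rule covering_number_pigeonhole)
    show "bounded (F \<inter> cball x R)" by (simp add: bounded_Int)
    show "F \<inter> cball x R \<subseteq> (\<Union>c\<in>I. P -` ball c r)"
    proof
      fix z assume z: "z \<in> F \<inter> cball x R"
      have "dist (P x) (P z) \<le> dist x z"
        using assms(3)[of "x - z"] by (simp add: dist_norm linear_diff[OF assms(2)])
      then have "P z \<in> P ` F \<inter> cball (P x) R" using z by auto
      then show "z \<in> (\<Union>c\<in>I. P -` ball c r)" using I(3) by blast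
    qed
    show "real (card I) \<le> C * (R / r) powr t" using C(2) r I(2) by auto
    show "M * (R / r) powr a * (C * (R / r) powr t) < real (covering_number r (F \<inter> cball x R))"
      using big by (simp add: powr_add mult_ac)
  qed (use r I assms in auto)
  then show thesis using that r by blast
qed

section \<open>Scales of Frostman type\<close>

text \<open>The set \<open>T\<close> is the part of \<open>F\<close> in a tube of width \<open>r\<close>. Call \<open>(z, i)\<close> rich if the ball around \<open>z\<close>
  of radius \<open>2 ^ i * r\<close> satisfies \<open>K * (2 ^ i) powr a \<le> covering_number r (T \<inter> cball z (2 ^ i * r))\<close>.
  If \<open>j\<close> is the least index with a rich ball, then all smaller balls are poor, and comparing them
  with the rich one gives the growth condition at all scales in between, with no iteration. Two
  points control the scale \<open>\<rho> = 2 ^ j * r\<close>. It is small because the tube at scale \<open>R\<close> is so large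
  that even one of its pieces of radius \<open>\<eta> * R\<close> is rich. It is large compared with \<open>r\<close> because a rich
  ball has covering number at least \<open>K\<close>, which by polynomial growth forces \<open>2 ^ j\<close> to be large.\<close>

lemma ball_with_frostman_growth:
  fixes F :: "'a::euclidean_space set" and P :: "'a \<Rightarrow> 'a"
  assumes "compact F" "linear P" "\<And>v. norm (P v) \<le> norm v"
    and "0 \<le> a" "a < assouad_dim F - assouad_dim (P ` F)" "0 < \<eta>"
  obtains T y r \<rho> where "T \<subseteq> F" "y \<in> T" "0 < r" "r \<le> \<eta> * \<rho>" "\<rho> \<le> \<eta>"
    "\<And>z. z \<in> T \<Longrightarrow> norm (P z - P y) \<le> 2 * r"
    "\<And>z \<sigma>. z \<in> T \<Longrightarrow> r \<le> \<sigma> \<Longrightarrow> 2 * \<sigma> < \<rho> \<Longrightarrow>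
      real (covering_number r (T \<inter> cball z \<sigma>))
        \<le> (2 * \<sigma> / \<rho>) powr a * real (covering_number r (T \<inter> cball y \<rho>))"
proof -
  obtain q :: nat where "0 < q" and q: "\<And>(E::'a set) y r \<rho>.
      0 < r \<Longrightarrow> r \<le> \<rho> \<Longrightarrow> E \<subseteq> cball y \<rho> \<Longrightarrow> real (covering_number r E) \<le> (2 * \<rho> / r) ^ q"
    using covering_number_cball_polynomial[where 'a = 'a] by blast
  define e where "e = min \<eta> 1"
  have e: "0 < e" "e \<le> 1" "e \<le> \<eta>" using assms(6) by (auto simp: e_def)
  \<comment> \<open>\<open>K\<close> makes a rich ball much larger than \<open>r\<close>; the further factor \<open>(8 / e) ^ q\<close> below pays for the
    number of balls of radius about \<open>e * R\<close> that cover \<open>cball x R\<close>.\<close>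
  define K where "K = (2 / e) ^ q"
  have K: "1 \<le> K" unfolding K_def using e by (intro one_le_power) simp
  have D: "1 \<le> (8 / e) ^ q" using e by (intro one_le_power) simp
  obtain r R x c where r: "0 < r" "r \<le> R" "R \<le> 1"
    and big: "K * (8 / e) ^ q * (R / r) powr a
      < real (covering_number r ((F \<inter> cball x R) \<inter> P -` ball c r))"
  proof (rule tube_with_large_covering_number[OF assms(1-5), of "K * (8 / e) ^ q"])
    show "0 < K * (8 / e) ^ q" using K e by simp
  qed
  define T where "T = F \<inter> P -` ball c r"
  have TF: "T \<subseteq> F" by (auto simp: T_def)
  have bT: "bounded (T \<inter> S)" for S
    using assms(1) TF by (meson bounded_subset compact_imp_bounded inf_le1 order_trans)
  have big: "K * (R / r) powr a * (8 / e) ^ q < real (covering_number r (T \<inter> cball x R))"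
    using big by (simp add: T_def mult_ac Int_ac)
  have Rr: "1 \<le> (R / r) powr a"
    using r assms(4) by (intro ge_one_powr_ge_zero) auto

  have "e * R > r"
  proof -
    have "K \<le> K * (R / r) powr a * (8 / e) ^ q"
      using mult_mono[OF mult_mono[OF order_refl[of K] Rr] D] K by simp
    also have "\<dots> < (2 * R / r) ^ q"
      using big q[OF r(1,2) Int_lower2[of T "cball x R"]] by linarith
    finally have "(2 / e) ^ q < (2 * R / r) ^ q" by (simp add: K_def)
    then have "2 / e < 2 * R / r"
      by (rule power_less_imp_less_base) (use r in auto)
    then show ?thesis using e r by (simp add: field_simps)
  qed
  then have "1 \<le> e * R / r" using r by simp
  then obtain j0 where j0: "2 ^ j0 \<le> e * R / r" "e * R / r < 2 ^ Suc j0"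
    by (rule power_of_two_bracket)
  define \<rho>0 where "\<rho>0 = 2 ^ j0 * r"
  have \<rho>0: "0 < \<rho>0" "\<rho>0 \<le> e * R" "e * R < 2 * \<rho>0"
    using j0 r by (auto simp: \<rho>0_def field_simps)
  have "\<rho>0 \<le> R" using \<rho>0(2) e r mult_left_le_one_le[of R e] by linarith

  have start: "\<exists>y\<in>T. K * (2 ^ j0) powr a \<le> real (covering_number r (T \<inter> cball y (2 ^ j0 * r)))"
  proof -
    obtain I where I: "finite I" "card I = covering_number (\<rho>0 / 2) (cball x R)"
        "cball x R \<subseteq> (\<Union>c\<in>I. ball c (\<rho>0 / 2))"
      using covering_number_attained[of "cball x R" "\<rho>0 / 2"] \<rho>0 by auto
    have "real (card I) \<le> (2 * R / (\<rho>0 / 2)) ^ q"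
      unfolding I(2) using \<rho>0 \<open>\<rho>0 \<le> R\<close> by (intro q[of _ _ _ x]) auto
    also have "\<dots> \<le> (8 / e) ^ q"
      using \<rho>0 e r by (intro power_mono) (auto simp: field_simps)
    finally have cI: "real (card I) \<le> (8 / e) ^ q" .
    have "\<exists>c\<in>I. K * (R / r) powr a < real (covering_number r ((T \<inter> cball x R) \<inter> ball c (\<rho>0 / 2)))"
      by (rule covering_number_pigeonhole[OF bT r(1) I(1) _ cI _ big]) (use I(3) K in auto)
    then obtain c' where c': "K * (R / r) powr a
        < real (covering_number r ((T \<inter> cball x R) \<inter> ball c' (\<rho>0 / 2)))" by blast
    have "(T \<inter> cball x R) \<inter> ball c' (\<rho>0 / 2) \<noteq> {}"
    proof
      assume "(T \<inter> cball x R) \<inter> ball c' (\<rho>0 / 2) = {}"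
      then have "K * (R / r) powr a < 0" using c' by simp
      moreover have "0 \<le> K * (R / r) powr a" using K by simp
      ultimately show False by linarith
    qed
    then obtain y0 where y0: "y0 \<in> T" "dist c' y0 < \<rho>0 / 2" by auto
    have sub: "(T \<inter> cball x R) \<inter> ball c' (\<rho>0 / 2) \<subseteq> T \<inter> cball y0 \<rho>0"
    proof
      fix z assume z: "z \<in> (T \<inter> cball x R) \<inter> ball c' (\<rho>0 / 2)"
      then show "z \<in> T \<inter> cball y0 \<rho>0"
        using y0 dist_triangle3[of y0 z c'] by auto
    qed
    have "2 ^ j0 \<le> R / r" using \<open>\<rho>0 \<le> R\<close> r by (simp add: \<rho>0_def field_simps)
    then have "K * (2 ^ j0) powr a \<le> K * (R / r) powr a"
      using K assms(4) by (intro mult_left_mono powr_mono2) auto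
    also have "\<dots> \<le> real (covering_number r (T \<inter> cball y0 \<rho>0))"
      using c' of_nat_mono[OF covering_number_mono[OF bT r(1) sub], where 'a = real] by linarith
    finally show ?thesis using y0(1) by (auto simp: \<rho>0_def)
  qed

  define Q where "Q j \<longleftrightarrow> (\<exists>y\<in>T. K * (2 ^ j) powr a \<le> real (covering_number r (T \<inter> cball y (2 ^ j * r))))"
    for j :: nat
  define j where "j = (LEAST j. Q j)"
  have "Q j0" using start by (simp add: Q_def)
  then have "Q j" and "j \<le> j0" unfolding j_def by (rule LeastI, rule Least_le)
  then obtain y where y: "y \<in> T" "K * (2 ^ j) powr a \<le> real (covering_number r (T \<inter> cball y (2 ^ j * r)))"
    by (auto simp: Q_def)
  have minimal: "real (covering_number r (T \<inter> cball z (2 ^ i * r))) < K * (2 ^ i) powr a"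
    if "i < j" "z \<in> T" for i z
    using not_less_Least[of i Q] that by (auto simp: j_def Q_def not_le)
  define \<rho> where "\<rho> = 2 ^ j * r"
  have \<rho>: "0 < \<rho>" using r by (simp add: \<rho>_def)
  show thesis
  proof
    show "T \<subseteq> F" "y \<in> T" "0 < r" by fact+
    have "\<rho> \<le> \<rho>0" unfolding \<rho>_def \<rho>0_def using \<open>j \<le> j0\<close> r by simp
    also have "\<dots> \<le> \<eta>" using \<rho>0(2) e r mult_mono[of e \<eta> R 1] assms(6) by simp
    finally show "\<rho> \<le> \<eta>" .
    have "K \<le> K * (2 ^ j) powr a"
      using K assms(4) by (simp add: ge_one_powr_ge_zero)
    also have "\<dots> \<le> (2 * (2 ^ j * r) / r) ^ q"
      by (rule order_trans[OF y(2)], rule q[of _ _ _ y]) (use r in auto)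
    finally have "(2 / e) ^ q \<le> (2 * 2 ^ j) ^ q" using r by (simp add: K_def)
    then have "2 / e \<le> 2 * 2 ^ j"
      by (rule power_mono_iff[THEN iffD1, rotated 3]) (use e \<open>0 < q\<close> in auto)
    then have "r \<le> e * \<rho>" using e r by (simp add: \<rho>_def field_simps)
    also have "\<dots> \<le> \<eta> * \<rho>" using e \<rho> by simp
    finally show "r \<le> \<eta> * \<rho>" .
    show "norm (P z - P y) \<le> 2 * r" if "z \<in> T" for z
    proof -
      have "dist c (P z) < r" "dist c (P y) < r" using that y(1) by (auto simp: T_def)
      then show ?thesis using dist_triangle3[of "P z" "P y" c] by (simp add: dist_norm)
    qed
    show "real (covering_number r (T \<inter> cball z \<sigma>))
        \<le> (2 * \<sigma> / \<rho>) powr a * real (covering_number r (T \<inter> cball y \<rho>))"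
      if z: "z \<in> T" and \<sigma>: "r \<le> \<sigma>" "2 * \<sigma> < \<rho>" for z \<sigma>
    proof -
      have "1 \<le> \<sigma> / r" using \<sigma> r by simp
      then obtain i where i: "2 ^ i \<le> \<sigma> / r" "\<sigma> / r < 2 ^ Suc i"
        by (rule power_of_two_bracket)
      \<comment> \<open>Rounding \<open>\<sigma>\<close> up to a dyadic scale costs a factor 2, hence the margin \<open>2 * \<sigma> < \<rho>\<close>.\<close>
      have "2 ^ i * r \<le> \<sigma>" using i(1) r by (simp add: pos_le_divide_eq)
      then have "2 ^ Suc i * r < 2 ^ j * r" using \<sigma>(2) by (simp add: \<rho>_def)
      then have "2 ^ Suc i < (2 ^ j :: real)"
        by (rule mult_right_less_imp_less) (use r in simp)
      then have "Suc i < j" by (rule power_less_imp_less_exp[rotated]) simp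
      have "T \<inter> cball z \<sigma> \<subseteq> T \<inter> cball z (2 ^ Suc i * r)"
        using i(2) r by (auto simp: field_simps)
      then have "real (covering_number r (T \<inter> cball z \<sigma>))
          \<le> real (covering_number r (T \<inter> cball z (2 ^ Suc i * r)))"
        using covering_number_mono[OF bT r(1)] by simp
      also have "\<dots> \<le> K * (2 ^ Suc i) powr a" using minimal[OF \<open>Suc i < j\<close> z] by simp
      also have "\<dots> \<le> K * (2 * \<sigma> / r) powr a"
        using K assms(4) i(1) by (intro mult_left_mono powr_mono2) auto
      also have "\<dots> = (2 * \<sigma> / \<rho>) powr a * (K * (2 ^ j) powr a)"
      proof -
        have "2 * \<sigma> / r = (2 * \<sigma> / \<rho>) * 2 ^ j" using r by (simp add: \<rho>_def)
        moreover have "((2 * \<sigma> / \<rho>) * 2 ^ j) powr a = (2 * \<sigma> / \<rho>) powr a * (2 ^ j) powr a"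
          by (rule powr_mult)
        ultimately show ?thesis by (simp only: mult_ac)
      qed
      also have "\<dots> \<le> (2 * \<sigma> / \<rho>) powr a * real (covering_number r (T \<inter> cball y \<rho>))"
        using y(2) by (intro mult_left_mono) (auto simp: \<rho>_def)
      finally show ?thesis .
    qed
  qed
qed

section \<open>Compactness of the space of tangents\<close>

lemma hausdorff_dist_le:
  assumes "A \<noteq> {}" "B \<noteq> {}" "\<And>a. a \<in> A \<Longrightarrow> infdist a B \<le> e" "\<And>b. b \<in> B \<Longrightarrow> infdist b A \<le> e"
  shows "\<bar>hausdorff_dist A B\<bar> \<le> e"
proof -
  obtain a where a: "a \<in> A" using assms(1) by blast
  have "hausdorff_dist A B \<le> e"
    unfolding hausdorff_dist_def using assms by (auto intro!: cSUP_least)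
  moreover have "infdist a B \<le> (SUP a\<in>A. infdist a B)"
    using a assms(3) by (intro cSUP_upper bdd_aboveI2[of _ _ e]) auto
  then have "0 \<le> hausdorff_dist A B"
    unfolding hausdorff_dist_def using infdist_nonneg[of a B] by linarith
  ultimately show ?thesis by simp
qed

text \<open>Blaschke's selection theorem. The functions \<open>\<lambda>x. infdist x (G n)\<close> are 1-Lipschitz and bounded on
  \<open>S\<close>, so by the Arzela--Ascoli theorem a subsequence converges uniformly to some \<open>g\<close>, and \<open>E\<close> is the
  zero set of \<open>g\<close>. The last conclusion is the form in which convergence is used with open
  covers of \<open>E\<close>. The common point \<open>w\<close> keeps the sets and their limit non-empty.\<close>

lemma hausdorff_convergent_subsequence:
  fixes G :: "nat \<Rightarrow> 'a::euclidean_space set"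
  assumes "compact S" "\<And>n. G n \<subseteq> S" "\<And>n. w \<in> G n"
  obtains E k where "compact E" "E \<subseteq> S" "w \<in> E" "strict_mono (k :: nat \<Rightarrow> nat)"
    "(\<lambda>n. hausdorff_dist (G (k n)) E) \<longlonglongrightarrow> 0"
    "\<And>U. open U \<Longrightarrow> E \<subseteq> U \<Longrightarrow> \<forall>\<^sub>F n in sequentially. G (k n) \<subseteq> U"
proof -
  have Gne: "G n \<noteq> {}" for n using assms(3) by blast
  have lip: "\<bar>infdist x (G n) - infdist y (G n)\<bar> \<le> dist x y" for x y n
    using infdist_triangle[of x "G n" y] infdist_triangle[of y "G n" x] by (simp add: dist_commute)
  obtain g k where g: "continuous_on S g" and k: "strict_mono (k :: nat \<Rightarrow> nat)"
    and conv: "\<And>e. 0 < e \<Longrightarrow> \<exists>N. \<forall>n x. n \<ge> N \<and> x \<in> S \<longrightarrow> norm (infdist x (G (k n)) - g x) < e"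
  proof (rule Arzela_Ascoli[of S "\<lambda>n x. infdist x (G n)" "diameter S"])
    show "norm (infdist x (G n)) \<le> diameter S" if "x \<in> S" for n x
    proof -
      have "infdist x (G n) \<le> dist x w" using assms(3) by (rule infdist_le)
      also have "\<dots> \<le> diameter S"
        using assms that by (intro diameter_bounded_bound compact_imp_bounded) auto
      finally show ?thesis using infdist_nonneg[of x "G n"] by simp
    qed
    show "\<exists>d>0. \<forall>n y. y \<in> S \<and> norm (x - y) < d \<longrightarrow> norm (infdist x (G n) - infdist y (G n)) < e"
      if "0 < e" for x e
      using that lip by (intro exI[of _ e]) (auto simp: dist_norm intro: le_less_trans)
  qed (use assms in auto)
  have pw: "(\<lambda>n. infdist x (G (k n))) \<longlonglongrightarrow> g x" if "x \<in> S" for x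
    using conv that unfolding LIMSEQ_iff by meson
  define E where "E = {x \<in> S. g x = 0}"
  have "closed E"
    unfolding E_def using g compact_imp_closed[OF assms(1)]
    by (rule continuous_closed_preimage_constant)
  then have cE: "compact E"
    using assms(1) by (metis (no_types, lifting) E_def compact_Int_closed inf.absorb_iff2 mem_Collect_eq subsetI)
  have "w \<in> S" using assms(2,3) by blast
  then have "g w = 0"
    using pw[of w] assms(3) by (simp add: LIMSEQ_const_iff)
  then have wE: "w \<in> E" using \<open>w \<in> S\<close> by (simp add: E_def)

  have upper: "\<forall>\<^sub>F n in sequentially. G (k n) \<subseteq> U" if "open U" "E \<subseteq> U" for U
  proof (cases "S - U = {}")
    case True
    then show ?thesis using assms(2) by (intro always_eventually) blast
  next
    case False
    have "compact (S - U)" using assms(1) that(1) by (rule compact_diff)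
    moreover have "continuous_on (S - U) g" using g by (rule continuous_on_subset) auto
    \<comment> \<open>\<open>g\<close> is bounded away from 0 off \<open>U\<close>, whereas \<open>g\<close> is uniformly small on \<open>G (k n)\<close>.\<close>
    ultimately obtain m where m: "m \<in> S - U" "\<And>x. x \<in> S - U \<Longrightarrow> g m \<le> g x"
      using continuous_attains_inf[of "S - U" g] False by blast
    have "0 \<le> g m" using pw[of m] m(1) by (intro LIMSEQ_le_const[of _ "g m"]) (auto simp: infdist_nonneg)
    moreover have "g m \<noteq> 0" using m(1) that(2) by (auto simp: E_def)
    ultimately have "0 < g m" by simp
    then obtain N where N: "\<And>n x. n \<ge> N \<Longrightarrow> x \<in> S \<Longrightarrow> norm (infdist x (G (k n)) - g x) < g m"
      using conv[of "g m"] by blast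
    have "G (k n) \<subseteq> U" if "n \<ge> N" for n
    proof
      fix x assume x: "x \<in> G (k n)"
      then have "x \<in> S" using assms(2) by blast
      then have "\<bar>g x\<bar> < g m" using N[OF that, of x] x by simp
      then show "x \<in> U" using m(2)[of x] \<open>x \<in> S\<close> by (meson DiffI abs_ge_self le_less_trans not_le)
    qed
    then show ?thesis by (auto simp: eventually_sequentially)
  qed

  have "(\<lambda>n. hausdorff_dist (G (k n)) E) \<longlonglongrightarrow> 0"
  proof (rule tendstoI)
    fix e :: real assume e: "0 < e"
    define U where "U = {x. infdist x E < e / 2}"
    have "open U" unfolding U_def by (intro open_Collect_less continuous_intros)
    moreover have "E \<subseteq> U" using e by (auto simp: U_def)
    ultimately have "\<forall>\<^sub>F n in sequentially. G (k n) \<subseteq> U" by (rule upper)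
    moreover have "\<forall>\<^sub>F n in sequentially. \<forall>x\<in>S. norm (infdist x (G (k n)) - g x) < e / 2"
      using conv[of "e / 2"] e by (auto simp: eventually_sequentially)
    ultimately show "\<forall>\<^sub>F n in sequentially. dist (hausdorff_dist (G (k n)) E) 0 < e"
    proof eventually_elim
      case (elim n)
      have "\<bar>hausdorff_dist (G (k n)) E\<bar> \<le> e / 2"
      proof (rule hausdorff_dist_le[OF Gne])
        show "infdist a E \<le> e / 2" if "a \<in> G (k n)" for a
          using that elim(1) by (auto simp: U_def)
        show "infdist b (G (k n)) \<le> e / 2" if "b \<in> E" for b
          using that elim(2) by (force simp: E_def)
      qed (use wE in auto)
      then show ?case using e by simp
    qed
  qed
  then show thesis using that[OF cE _ wE k] upper by (auto simp: E_def)
qed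

lemma weak_tangent_subsequence:
  fixes F :: "'a::euclidean_space set"
  assumes "\<And>n. y n \<in> F" "\<And>n. 0 < \<rho> n" "\<And>n. \<rho> n \<le> 1" "\<rho> \<longlonglongrightarrow> 0"
  obtains E k where "E \<in> weak_tangents F" "0 \<in> E" "strict_mono (k :: nat \<Rightarrow> nat)"
    "\<And>U. open U \<Longrightarrow> E \<subseteq> U \<Longrightarrow> \<forall>\<^sub>F n in sequentially.
      (\<lambda>z. inverse (\<rho> (k n)) *\<^sub>R (z - y (k n))) ` F \<inter> cball 0 1 \<subseteq> U"
proof -
  define G where "G n = (\<lambda>z. inverse (\<rho> n) *\<^sub>R (z - y n)) ` F \<inter> cball 0 1" for n
  have G: "G n \<subseteq> cball 0 1" "0 \<in> G n" for n
    using assms(1)[of n] by (auto simp: G_def image_iff intro!: bexI[of _ "y n"])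
  obtain E k where E: "compact E" "E \<subseteq> cball 0 1" "0 \<in> E" and k: "strict_mono (k :: nat \<Rightarrow> nat)"
    and lim: "(\<lambda>n. hausdorff_dist (G (k n)) E) \<longlonglongrightarrow> 0"
    and upper: "\<And>U. open U \<Longrightarrow> E \<subseteq> U \<Longrightarrow> \<forall>\<^sub>F n in sequentially. G (k n) \<subseteq> U"
    by (rule hausdorff_convergent_subsequence[OF compact_cball G]) (rule that; assumption)
  have "(\<rho> \<circ> k) \<longlonglongrightarrow> 0" using assms(4) k by (rule LIMSEQ_subseq_LIMSEQ)
  then have "E \<in> weak_tangents F"
    unfolding weak_tangents_def using E assms lim
    by (auto simp: G_def intro!: exI[of _ "y \<circ> k"] exI[of _ "\<rho> \<circ> k"])
  then show thesis using that[OF _ E(3) k] upper by (simp add: G_def)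
qed

section \<open>Hausdorff measure\<close>

lemma diam_pow_eq: "0 < s \<Longrightarrow> diam_pow s U = ennreal (diameter U powr s)"
  by (simp add: diam_pow_def)

text \<open>Open covers are what compactness can use. Each set of a cheap cover is enlarged to a ball
  whose radius is chosen so that its \<open>s\<close>-th power exceeds that of the diameter by a geometrically decaying
  amount. For \<open>s > 0\<close> this also makes room around sets of diameter 0.\<close>

lemma null_set_open_ball_cover:
  fixes E :: "'a::euclidean_space set"
  assumes "hausdorff_measure s E = 0" "0 < s" "0 < e"
  obtains u :: "nat \<Rightarrow> 'a" and \<rho> :: "nat \<Rightarrow> real"
  where "\<And>i. 0 < \<rho> i" "E \<subseteq> (\<Union>i. ball (u i) (\<rho> i))"
    "\<And>I. finite I \<Longrightarrow> (\<Sum>i\<in>I. \<rho> i powr s) \<le> e"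
proof -
  have "hausdorff_premeasure s 1 E \<le> hausdorff_measure s E"
    unfolding hausdorff_measure_def by (rule SUP_upper) simp
  then have "hausdorff_premeasure s 1 E < ennreal (e / 2)" using assms(1,3) by simp
  then obtain U :: "nat \<Rightarrow> 'a set" where U: "E \<subseteq> (\<Union>i. U i)" "\<And>i. bounded (U i)"
      and small: "(\<Sum>i. diam_pow s (U i)) < ennreal (e / 2)"
    unfolding hausdorff_premeasure_def INF_less_iff by blast
  define d where "d i = diameter (U i)" for i
  have d: "0 \<le> d i" for i unfolding d_def by (rule diameter_ge_0[OF U(2)])
  define h where "h i = e / 2 * (1 / 2) ^ Suc i" for i :: nat
  have h: "0 < h i" for i using assms(3) by (simp add: h_def)
  have hsums: "h sums (e / 2)"
    using sums_mult[OF power_half_series, of "e / 2"] by (simp add: h_def[abs_def])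
  define \<rho> where "\<rho> i = (d i powr s + h i) powr (1 / s)" for i
  have \<rho>pow: "\<rho> i powr s = d i powr s + h i" for i
    using assms(2) h[of i] by (simp add: \<rho>_def powr_powr)
  have \<rho>pos: "0 < \<rho> i" for i
    using h[of i] by (simp add: \<rho>_def add_nonneg_pos less_imp_neq[symmetric])
  have \<rho>d: "d i < \<rho> i" for i
  proof (rule ccontr)
    assume "\<not> d i < \<rho> i"
    then have "\<rho> i powr s \<le> d i powr s" using \<rho>pos[of i] assms(2) by (intro powr_mono2) auto
    then show False using \<rho>pow[of i] h[of i] by simp
  qed
  \<comment> \<open>An empty \<open>U i\<close> gets an arbitrary centre, which does no harm to the cover.\<close>
  define u where "u i = (SOME x. x \<in> U i)" for i
  have "U i \<subseteq> ball (u i) (\<rho> i)" for i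
  proof
    fix x assume x: "x \<in> U i"
    then have "u i \<in> U i" unfolding u_def by (rule someI)
    then have "dist (u i) x \<le> d i" unfolding d_def using diameter_bounded_bound[OF U(2)] x by blast
    then show "x \<in> ball (u i) (\<rho> i)" using \<rho>d[of i] by simp
  qed
  then have "(\<Union>i. U i) \<subseteq> (\<Union>i. ball (u i) (\<rho> i))" by (intro UN_mono) auto
  with U(1) have cover: "E \<subseteq> (\<Union>i. ball (u i) (\<rho> i))" by (rule order_trans)
  have "(\<Sum>i\<in>I. \<rho> i powr s) \<le> e" if "finite I" for I
  proof -
    have "ennreal (\<Sum>i\<in>I. d i powr s) = (\<Sum>i\<in>I. diam_pow s (U i))"
      using assms(2) by (simp add: diam_pow_eq d_def sum_ennreal)
    also have "\<dots> \<le> (\<Sum>i. diam_pow s (U i))"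
      using that by (intro sum_le_suminf) auto
    finally have "ennreal (\<Sum>i\<in>I. d i powr s) \<le> ennreal (e / 2)" using small by simp
    then have "(\<Sum>i\<in>I. d i powr s) \<le> e / 2" using assms(3) by simp
    moreover have "(\<Sum>i\<in>I. h i) \<le> e / 2"
      using sum_le_suminf[OF sums_summable[OF hsums] that] h sums_unique[OF hsums]
      by (simp add: less_imp_le)
    ultimately show ?thesis by (simp add: \<rho>pow sum.distrib)
  qed
  then show thesis using that[OF \<rho>pos cover] by blast
qed

lemma hausdorff_measure_0_nonempty:
  assumes "E \<noteq> {}"
  shows "hausdorff_measure 0 E \<noteq> 0"
proof
  assume "hausdorff_measure 0 E = 0"
  moreover have "hausdorff_premeasure 0 1 E \<le> hausdorff_measure 0 E"
    unfolding hausdorff_measure_def by (rule SUP_upper) simp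
  ultimately have "hausdorff_premeasure 0 1 E < 1" by simp
  then obtain U :: "nat \<Rightarrow> 'a set" where U: "E \<subseteq> (\<Union>i. U i)" "(\<Sum>i. diam_pow 0 (U i)) < 1"
    unfolding hausdorff_premeasure_def INF_less_iff by blast
  obtain i where "U i \<noteq> {}" using assms U(1) by blast
  then have "1 \<le> (\<Sum>i\<in>{i}. diam_pow 0 (U i))" by (simp add: diam_pow_def)
  also have "\<dots> \<le> (\<Sum>i. diam_pow 0 (U i))" by (intro sum_le_suminf) auto
  finally show False using U(2) by simp
qed

text \<open>A lower bound on \<open>hausdorff_dim\<close> says nothing unless the infimum is taken over a non-empty set.
  With polynomially many balls of radius \<open>r\<close>, of degree \<open>q\<close>, the cost in dimension \<open>q + 1\<close> is of order \<open>r\<close>.\<close>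

lemma bounded_imp_hausdorff_measure_eq_0:
  fixes E :: "'a::euclidean_space set"
  assumes "bounded E"
  shows "\<exists>s\<ge>0. hausdorff_measure s E = 0"
proof -
  obtain q :: nat where "0 < q" and q: "\<And>(E::'a set) y r \<rho>.
      0 < r \<Longrightarrow> r \<le> \<rho> \<Longrightarrow> E \<subseteq> cball y \<rho> \<Longrightarrow> real (covering_number r E) \<le> (2 * \<rho> / r) ^ q"
    using covering_number_cball_polynomial[where 'a = 'a] by blast
  obtain B where B: "0 < B" "E \<subseteq> cball 0 B"
    using assms by (auto simp: bounded_pos subset_iff)
  define C where "C = (2 * B) ^ q * 2 ^ Suc q"
  have C: "0 < C" using B by (simp add: C_def)
  have bound: "hausdorff_premeasure (real (Suc q)) \<delta> E \<le> ennreal (C * r)"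
    if r: "0 < r" "r \<le> B" "2 * r \<le> \<delta>" for r \<delta>
  proof -
    obtain T where T: "finite T" "card T = covering_number r E" "E \<subseteq> (\<Union>c\<in>T. ball c r)"
      using covering_number_attained[OF assms r(1)] .
    have cT: "real (card T) \<le> (2 * B / r) ^ q" using q[OF r(1,2) B(2)] T(2) by simp
    obtain f where f: "bij_betw f {..<card T} T" using ex_bij_betw_nat_finite[OF T(1)]
      by (auto simp: atLeast0LessThan)
    define U where "U i = (if i < card T then ball (f i) r else {})" for i
    have "E \<subseteq> (\<Union>i. U i)"
    proof
      fix x assume "x \<in> E"
      then obtain c where c: "c \<in> T" "x \<in> ball c r" using T(3) by blast
      then obtain i where "i < card T" "f i = c" using f by (metis bij_betw_iff_bijections lessThan_iff)
      then show "x \<in> (\<Union>i. U i)" using c(2) by (auto simp: U_def)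
    qed
    moreover have dU: "bounded (U i)" "diameter (U i) \<le> 2 * r" for i
      using r(1) by (auto simp: U_def)
    ultimately have "hausdorff_premeasure (real (Suc q)) \<delta> E \<le> (\<Sum>i. diam_pow (real (Suc q)) (U i))"
      unfolding hausdorff_premeasure_def using r(3) by (intro INF_lower) (auto intro: order_trans)
    also have "\<dots> = (\<Sum>i<card T. diam_pow (real (Suc q)) (U i))"
      by (rule suminf_finite) (auto simp: U_def diam_pow_def)
    also have "\<dots> \<le> (\<Sum>i<card T. ennreal ((2 * r) ^ Suc q))"
    proof (rule sum_mono)
      fix i
      have "diameter (U i) powr real (Suc q) \<le> (2 * r) powr real (Suc q)"
        using dU(2)[of i] diameter_ge_0[OF dU(1)] by (intro powr_mono2) auto
      also have "\<dots> = (2 * r) ^ Suc q" using r(1) by (subst powr_realpow) auto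
      finally show "diam_pow (real (Suc q)) (U i) \<le> ennreal ((2 * r) ^ Suc q)"
        by (subst diam_pow_eq) (auto intro: ennreal_leI)
    qed
    also have "\<dots> = ennreal (real (card T) * (2 * r) ^ Suc q)"
      using r(1) by (simp add: ennreal_mult ennreal_of_nat_eq_real_of_nat)
    also have "\<dots> \<le> ennreal (C * r)"
    proof (rule ennreal_leI)
      have "real (card T) * (2 * r) ^ Suc q \<le> (2 * B / r) ^ q * (2 * r) ^ Suc q"
        using cT r(1) by (intro mult_right_mono) auto
      also have "\<dots> = C * r"
        using r(1) by (simp add: C_def power_divide power_mult_distrib)
      finally show "real (card T) * (2 * r) ^ Suc q \<le> C * r" .
    qed
    finally show ?thesis .
  qed
  have "hausdorff_premeasure (real (Suc q)) \<delta> E \<le> 0" if "0 < \<delta>" for \<delta>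
  proof (rule ennreal_le_epsilon)
    fix e :: real assume e: "0 < e"
    define r where "r = min (min B (\<delta> / 2)) (e / C)"
    have r: "0 < r" "r \<le> B" "2 * r \<le> \<delta>" "r \<le> e / C"
      using B(1) that e C by (auto simp: r_def)
    have "C * r \<le> e" using r(4) C by (simp add: field_simps)
    then show "hausdorff_premeasure (real (Suc q)) \<delta> E \<le> 0 + ennreal e"
      using bound[OF r(1-3)] by (simp add: ennreal_leI order_trans)
  qed
  then have "hausdorff_measure (real (Suc q)) E = 0"
    unfolding hausdorff_measure_def by (intro antisym SUP_least) auto
  then show ?thesis by (intro exI[of _ "real (Suc q)"]) simp
qed

lemma hausdorff_dim_geI:
  fixes E :: "'a::euclidean_space set"
  assumes "bounded E" "\<And>s. 0 \<le> s \<Longrightarrow> s < d \<Longrightarrow> hausdorff_measure s E \<noteq> 0"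
  shows "max d 0 \<le> hausdorff_dim E"
  unfolding hausdorff_dim_def
proof (rule cInf_greatest)
  show "{s. 0 \<le> s \<and> hausdorff_measure s E = 0} \<noteq> {}"
    using bounded_imp_hausdorff_measure_eq_0[OF assms(1)] by blast
  show "max d 0 \<le> s" if "s \<in> {s. 0 \<le> s \<and> hausdorff_measure s E = 0}" for s
    using that assms(2)[of s] by (cases "s < d") auto
qed

section \<open>Orthogonal projections\<close>

lemma orth_proj_eqI:
  assumes "subspace W" "p \<in> W" "\<And>w. w \<in> W \<Longrightarrow> orthogonal (v - p) w"
  shows "orth_proj W v = p"
  unfolding orth_proj_def
proof (rule the_equality)
  fix p' assume p': "p' \<in> W \<and> (\<forall>w\<in>W. orthogonal (v - p') w)"
  have "p' - p \<in> W" using assms(1,2) p' by (simp add: subspace_diff)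
  then have "(v - p) \<bullet> (p' - p) = 0" "(v - p') \<bullet> (p' - p) = 0"
    using assms(3) p' by (auto simp: orthogonal_def)
  then have "(p' - p) \<bullet> (p' - p) = 0" by (simp add: algebra_simps)
  then show "p' = p" by simp
qed (use assms in auto)

lemma orth_proj_in_and_orthogonal:
  assumes "subspace W"
  shows "orth_proj W v \<in> W" and "w \<in> W \<Longrightarrow> orthogonal (v - orth_proj W v) w"
proof -
  obtain p z where p: "p \<in> span W" "\<And>w. w \<in> span W \<Longrightarrow> orthogonal z w" "v = p + z"
    using orthogonal_subspace_decomp_exists[of W v] by blast
  have "span W = W" using assms by (simp add: span_eq_iff)
  note p = p[unfolded this]
  have "orth_proj W v = p"
    using assms p by (intro orth_proj_eqI) auto
  then show "orth_proj W v \<in> W" "w \<in> W \<Longrightarrow> orthogonal (v - orth_proj W v) w"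
    using p by auto
qed

lemma linear_orth_proj:
  assumes "subspace W"
  shows "linear (orth_proj W)"
proof (rule linearI)
  note P = orth_proj_in_and_orthogonal[OF assms]
  show "orth_proj W (v + v') = orth_proj W v + orth_proj W v'" for v v'
  proof (rule orth_proj_eqI[OF assms])
    show "orthogonal (v + v' - (orth_proj W v + orth_proj W v')) w" if "w \<in> W" for w
      using P(2)[OF that, of v] P(2)[OF that, of v'] by (simp add: orthogonal_def inner_diff_left inner_add_left)
  qed (use assms P in \<open>auto simp: subspace_add\<close>)
  show "orth_proj W (c *\<^sub>R v) = c *\<^sub>R orth_proj W v" for c v
  proof (rule orth_proj_eqI[OF assms])
    show "orthogonal (c *\<^sub>R v - c *\<^sub>R orth_proj W v) w" if "w \<in> W" for w
      using P(2)[OF that, of v] by (simp add: orthogonal_def inner_diff_left)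
  qed (use assms P in \<open>auto simp: subspace_scale\<close>)
qed

lemma norm_orth_proj_le:
  assumes "subspace W"
  shows "norm (orth_proj W v) \<le> norm v"
proof -
  note P = orth_proj_in_and_orthogonal[OF assms]
  have "orthogonal (v - orth_proj W v) (orth_proj W v)" using P by blast
  then have "(norm v)\<^sup>2 = (norm (v - orth_proj W v))\<^sup>2 + (norm (orth_proj W v))\<^sup>2"
    using norm_add_Pythagorean[of "v - orth_proj W v" "orth_proj W v"] by simp
  then have "(norm (orth_proj W v))\<^sup>2 \<le> (norm v)\<^sup>2" by simp
  then show ?thesis by (rule power2_le_imp_le) simp
qed

section \<open>Large fibres of tangents\<close>

text \<open>Points of rescaled tubes are only nearly in the kernel of the projection; the margin \<open>m\<close> lets a cover
  of the exact fibre catch them too.\<close>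

lemma compact_zero_set_neighbourhood:
  fixes f :: "'a::metric_space \<Rightarrow> real"
  assumes "compact E" "open V" "continuous_on UNIV f" "\<And>z. 0 \<le> f z"
    and "\<And>z. z \<in> E \<Longrightarrow> f z = 0 \<Longrightarrow> z \<in> V"
  obtains m where "0 < m" "E \<subseteq> V \<union> {z. m < f z}"
proof (cases "E - V = {}")
  case True
  then show thesis using that[of 1] by auto
next
  case False
  have "compact (E - V)" using assms(1,2) by (rule compact_diff)
  moreover have "continuous_on (E - V) f" using assms(3) by (rule continuous_on_subset) simp
  ultimately obtain w where w: "w \<in> E - V" "\<And>z. z \<in> E - V \<Longrightarrow> f w \<le> f z"
    using continuous_attains_inf[of "E - V" f] False by blast
  have "f w \<noteq> 0" using w(1) assms(5) by blast
  then have "0 < f w" using assms(4)[of w] by simp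
  moreover have "E \<subseteq> V \<union> {z. f w / 2 < f z}"
  proof
    fix z assume "z \<in> E"
    then show "z \<in> V \<union> {z. f w / 2 < f z}" using w(2)[of z] \<open>0 < f w\<close> by (cases "z \<in> V") auto
  qed
  ultimately show thesis using that[of "f w / 2"] by simp
qed

text \<open>The mass distribution principle, with the subadditive covering number at scale \<open>r\<close> in the place of
  a measure, so that no limit measure has to be constructed. In \<open>T\<close>, a ball of the cover has relative mass
  at most \<open>(4 * \<delta> i) powr a\<close>, and the relative masses add up to at least 1. One factor 2
  comes from recentring the ball at a point of \<open>T\<close>, the other from the growth condition.\<close>

lemma frostman_growth_imp_covering_cost_ge_1:
  fixes T :: "'a::euclidean_space set"
  assumes "bounded T" "y \<in> T" "0 < r" "0 < \<rho>" "finite I"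
    and growth: "\<And>z \<sigma>. z \<in> T \<Longrightarrow> r \<le> \<sigma> \<Longrightarrow> 2 * \<sigma> < \<rho> \<Longrightarrow>
      real (covering_number r (T \<inter> cball z \<sigma>))
        \<le> (2 * \<sigma> / \<rho>) powr a * real (covering_number r (T \<inter> cball y \<rho>))"
    and \<delta>: "\<And>i. i \<in> I \<Longrightarrow> 0 < \<delta> i \<and> r \<le> 2 * \<delta> i * \<rho> \<and> 4 * \<delta> i < 1"
    and cover: "\<And>z. z \<in> T \<Longrightarrow> dist y z \<le> \<rho> \<Longrightarrow> inverse \<rho> *\<^sub>R (z - y) \<in> (\<Union>i\<in>I. ball (u i) (\<delta> i))"
  shows "1 \<le> (\<Sum>i\<in>I. (4 * \<delta> i) powr a)"
proof -
  define N where "N = real (covering_number r (T \<inter> cball y \<rho>))"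
  define A where "A i = {z. inverse \<rho> *\<^sub>R (z - y) \<in> ball (u i) (\<delta> i)}" for i
  have bT: "bounded (T \<inter> S)" for S using assms(1) by (simp add: bounded_Int)
  have "0 < N"
  proof -
    have "y \<in> T \<inter> cball y \<rho>" using assms(2,4) by simp
    then show ?thesis
      unfolding N_def using covering_number_pos[OF bT assms(3)] by (metis empty_iff of_nat_0_less_iff)
  qed
  have piece: "real (covering_number r ((T \<inter> cball y \<rho>) \<inter> A i)) \<le> (4 * \<delta> i) powr a * N"
    if i: "i \<in> I" for i
  proof (cases "(T \<inter> cball y \<rho>) \<inter> A i = {}")
    case True
    then show ?thesis using \<open>0 < N\<close> by simp
  next
    case False
    then obtain w where w: "w \<in> T" "w \<in> A i" by blast
    have "(T \<inter> cball y \<rho>) \<inter> A i \<subseteq> T \<inter> cball w (2 * \<delta> i * \<rho>)"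
    proof
      fix z assume z: "z \<in> (T \<inter> cball y \<rho>) \<inter> A i"
      have "dist (inverse \<rho> *\<^sub>R (w - y)) (inverse \<rho> *\<^sub>R (z - y)) < 2 * \<delta> i"
        using w(2) z dist_triangle3[of "inverse \<rho> *\<^sub>R (w - y)" "inverse \<rho> *\<^sub>R (z - y)" "u i"]
        by (simp add: A_def)
      moreover have "inverse \<rho> *\<^sub>R (w - y) - inverse \<rho> *\<^sub>R (z - y) = inverse \<rho> *\<^sub>R (w - z)"
        by (simp add: algebra_simps)
      ultimately have "inverse \<rho> * dist w z < 2 * \<delta> i"
        using assms(4) by (simp add: dist_norm)
      then have "dist w z \<le> 2 * \<delta> i * \<rho>"
        using assms(4) by (simp add: field_simps)
      then show "z \<in> T \<inter> cball w (2 * \<delta> i * \<rho>)" using z by simp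
    qed
    then have "real (covering_number r ((T \<inter> cball y \<rho>) \<inter> A i))
        \<le> real (covering_number r (T \<inter> cball w (2 * \<delta> i * \<rho>)))"
      using covering_number_mono[OF bT assms(3)] by simp
    also have "\<dots> \<le> (2 * (2 * \<delta> i * \<rho>) / \<rho>) powr a * N"
      unfolding N_def using \<delta>[OF i] assms(4) by (intro growth w) auto
    also have "2 * (2 * \<delta> i * \<rho>) / \<rho> = 4 * \<delta> i" using assms(4) by simp
    finally show ?thesis .
  qed
  have "T \<inter> cball y \<rho> \<subseteq> (\<Union>i\<in>I. A i)" using cover by (auto simp: A_def)
  then have "covering_number r (T \<inter> cball y \<rho>)
      \<le> (\<Sum>i\<in>I. covering_number r ((T \<inter> cball y \<rho>) \<inter> A i))"
    by (rule covering_number_UN_le[OF bT assms(3,5)])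
  then have "N \<le> (\<Sum>i\<in>I. real (covering_number r ((T \<inter> cball y \<rho>) \<inter> A i)))"
    unfolding N_def by (metis of_nat_le_iff of_nat_sum)
  also have "\<dots> \<le> (\<Sum>i\<in>I. (4 * \<delta> i) powr a * N)" using piece by (rule sum_mono)
  also have "\<dots> = (\<Sum>i\<in>I. (4 * \<delta> i) powr a) * N" by (simp add: sum_distrib_right)
  finally show ?thesis using \<open>0 < N\<close> by simp
qed

text \<open>Take balls of Frostman growth with \<open>\<eta>\<close> tending to 0 and exponents tending to the difference \<open>d\<close> of
  the dimensions, and let \<open>E\<close> be a limit of the magnifications of \<open>F\<close> at these balls. The rescaled tubes
  have width \<open>r / \<rho>\<close> tending to 0, so in the limit they shrink to the fibre over 0. A cheap cover
  of that fibre would, by compactness, cover a rescaled tube, against its Frostman growth.\<close>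

theorem tangent_with_large_fibre:
  fixes F :: "'a::euclidean_space set" and P :: "'a \<Rightarrow> 'a"
  assumes "compact F" "F \<noteq> {}" "linear P" "\<And>v. norm (P v) \<le> norm v"
  shows "\<exists>E\<in>weak_tangents F. 0 \<in> E \<and>
    max (assouad_dim F - assouad_dim (P ` F)) 0 \<le> hausdorff_dim (P -` {0} \<inter> E)"
proof (cases "assouad_dim F - assouad_dim (P ` F) \<le> 0")
  case True
  obtain w where "w \<in> F" using assms(2) by blast
  moreover have "inverse (real (Suc n)) \<le> 1" for n by (simp add: field_simps)
  ultimately obtain E where E: "E \<in> weak_tangents F" "0 \<in> E"
    using weak_tangent_subsequence[of "\<lambda>_. w" F "\<lambda>n. inverse (real (Suc n))"]
      LIMSEQ_inverse_real_of_nat by (metis inverse_positive_iff_positive of_nat_0_less_iff zero_less_Suc)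
  have "bounded (P -` {0} \<inter> E)"
    using E(1) by (auto simp: weak_tangents_def intro: compact_imp_bounded)
  then have "max (assouad_dim F - assouad_dim (P ` F)) 0 \<le> hausdorff_dim (P -` {0} \<inter> E)"
    by (rule hausdorff_dim_geI) (use True in auto)
  then show ?thesis using E by blast
next
  case False
  define d where "d = assouad_dim F - assouad_dim (P ` F)"
  have d: "0 < d" using False by (simp add: d_def)
  \<comment> \<open>Any sequence that increases to \<open>d\<close> from non-negative values would do.\<close>
  define a where "a n = d - d / real (n + 2)" for n :: nat
  have a: "0 \<le> a n" "a n < d" for n
    using d by (auto simp: a_def field_simps)
  have "(\<lambda>n. d - d / real (n + 2)) \<longlonglongrightarrow> d - 0"
    by (intro tendsto_diff tendsto_const LIMSEQ_ignore_initial_segment lim_const_over_n)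
  then have a_lim: "a \<longlonglongrightarrow> d" by (simp add: a_def[abs_def])

  define Q where "Q n T y r \<rho> \<longleftrightarrow> T \<subseteq> F \<and> y \<in> T \<and> 0 < r \<and> r \<le> inverse (real (Suc n)) * \<rho> \<and>
      \<rho> \<le> inverse (real (Suc n)) \<and> (\<forall>z\<in>T. norm (P z - P y) \<le> 2 * r) \<and>
      (\<forall>z\<in>T. \<forall>\<sigma>. r \<le> \<sigma> \<longrightarrow> 2 * \<sigma> < \<rho> \<longrightarrow> real (covering_number r (T \<inter> cball z \<sigma>))
        \<le> (2 * \<sigma> / \<rho>) powr a n * real (covering_number r (T \<inter> cball y \<rho>)))" for n T y r \<rho>
  have "\<exists>T y r \<rho>. Q n T y r \<rho>" for n
  proof -
    have \<eta>: "0 < inverse (real (Suc n))" by simp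
    show ?thesis
    proof (rule ball_with_frostman_growth[OF assms(1,3,4) a(1)[of n] a(2)[of n, unfolded d_def] \<eta>])
      fix T y r \<rho>
      assume "T \<subseteq> F" "y \<in> T" "0 < r" "r \<le> inverse (real (Suc n)) * \<rho>" "\<rho> \<le> inverse (real (Suc n))"
        "\<And>z. z \<in> T \<Longrightarrow> norm (P z - P y) \<le> 2 * r"
        "\<And>z \<sigma>. z \<in> T \<Longrightarrow> r \<le> \<sigma> \<Longrightarrow> 2 * \<sigma> < \<rho> \<Longrightarrow> real (covering_number r (T \<inter> cball z \<sigma>))
          \<le> (2 * \<sigma> / \<rho>) powr a n * real (covering_number r (T \<inter> cball y \<rho>))"
      then have "Q n T y r \<rho>" unfolding Q_def by simp
      then show ?thesis by blast
    qed
  qed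
  then obtain T y r \<rho> where Q: "\<And>n. Q n (T n) (y n) (r n) (\<rho> n)" by metis
  have TF: "T n \<subseteq> F" "y n \<in> T n" "0 < r n" "r n \<le> inverse (real (Suc n)) * \<rho> n"
    "\<rho> n \<le> inverse (real (Suc n))" "\<And>z. z \<in> T n \<Longrightarrow> norm (P z - P (y n)) \<le> 2 * r n" for n
    using Q[of n] by (auto simp: Q_def)
  have growth: "real (covering_number (r n) (T n \<inter> cball z \<sigma>))
        \<le> (2 * \<sigma> / \<rho> n) powr a n * real (covering_number (r n) (T n \<inter> cball (y n) (\<rho> n)))"
    if "z \<in> T n" "r n \<le> \<sigma>" "2 * \<sigma> < \<rho> n" for n z \<sigma>
    using Q[of n] that by (auto simp: Q_def)
  have \<rho>: "0 < \<rho> n" for n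
  proof -
    have "0 < inverse (real (Suc n)) * \<rho> n" using TF(3,4)[of n] by linarith
    then show ?thesis by (simp add: zero_less_mult_iff)
  qed
  have \<rho>1: "\<rho> n \<le> 1" for n
    using TF(5)[of n] by (rule order_trans) (simp add: field_simps)
  have \<rho>_lim: "\<rho> \<longlonglongrightarrow> 0"
    by (rule tendsto_sandwich[OF _ _ tendsto_const LIMSEQ_inverse_real_of_nat])
      (use \<rho> TF(5) in \<open>auto intro!: always_eventually simp: less_imp_le\<close>)
  have "r n / \<rho> n \<le> inverse (real (Suc n))" for n
    using TF(4)[of n] \<rho>[of n] by (simp add: pos_divide_le_eq)
  then have ratio_lim: "(\<lambda>n. r n / \<rho> n) \<longlonglongrightarrow> 0"
    by (intro tendsto_sandwich[OF _ _ tendsto_const LIMSEQ_inverse_real_of_nat])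
      (use \<rho> TF(3) in \<open>auto intro!: always_eventually simp: less_imp_le\<close>)

  have yF: "y n \<in> F" for n using TF(1,2) by blast
  obtain E k where E: "E \<in> weak_tangents F" "0 \<in> E" and k: "strict_mono (k :: nat \<Rightarrow> nat)"
    and upper: "\<And>U. open U \<Longrightarrow> E \<subseteq> U \<Longrightarrow> \<forall>\<^sub>F n in sequentially.
      (\<lambda>z. inverse (\<rho> (k n)) *\<^sub>R (z - y (k n))) ` F \<inter> cball 0 1 \<subseteq> U"
    by (rule weak_tangent_subsequence[of y F \<rho>, OF yF \<rho> \<rho>1 \<rho>_lim]) (rule that; assumption)
  have cE: "compact E" using E(1) by (simp add: weak_tangents_def)
  have contP: "continuous_on UNIV P" using assms(3) by (rule linear_continuous_on[OF linear_conv_bounded_linear[THEN iffD1]])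
  have cK: "compact (P -` {0} \<inter> E)"
    using cE contP by (metis closed_singleton closed_vimage compact_Int_closed inf_commute)

  have "max d 0 \<le> hausdorff_dim (P -` {0} \<inter> E)"
  proof (rule hausdorff_dim_geI[OF compact_imp_bounded[OF cK]])
    fix s :: real assume s: "0 \<le> s" "s < d"
    show "hausdorff_measure s (P -` {0} \<inter> E) \<noteq> 0"
    proof (cases "s = 0")
      case True
      have "P -` {0} \<inter> E \<noteq> {}" using E(2) linear_0[OF assms(3)] by auto
      then show ?thesis unfolding True by (rule hausdorff_measure_0_nonempty)
    next
      case False
      then have s0: "0 < s" using s by simp
      \<comment> \<open>Multiplied by \<open>4 powr s\<close>, the loss in passing to relative masses, \<open>e\<close> is still less than 1.\<close>
      define e where "e = (1 / 4) powr s / 2"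
      have e: "0 < e" by (simp add: e_def)
      show ?thesis
      proof
        assume "hausdorff_measure s (P -` {0} \<inter> E) = 0"
        then obtain u \<delta> where \<delta>: "\<And>i. 0 < \<delta> i" and cover: "P -` {0} \<inter> E \<subseteq> (\<Union>i::nat. ball (u i) (\<delta> i))"
          and cost: "\<And>I. finite I \<Longrightarrow> (\<Sum>i\<in>I. \<delta> i powr s) \<le> e"
          using s0 e by (rule null_set_open_ball_cover) (rule that; assumption)
        have \<delta>4: "4 * \<delta> i < 1" for i
        proof (rule ccontr)
          assume "\<not> 4 * \<delta> i < 1"
          then have "(1 / 4) powr s \<le> \<delta> i powr s" using s0 by (intro powr_mono2) auto
          moreover have "\<delta> i powr s \<le> e" using cost[of "{i}"] by simp
          moreover have "(1 / 4) powr s = 2 * e" by (simp add: e_def)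
          ultimately show False using e by linarith
        qed
        obtain I where I: "finite I" "P -` {0} \<inter> E \<subseteq> (\<Union>i\<in>I. ball (u i) (\<delta> i))"
          using compactE_image[OF cK, of UNIV "\<lambda>i. ball (u i) (\<delta> i)"] cover by auto
        define V where "V = (\<Union>i\<in>I. ball (u i) (\<delta> i))"
        have "open V" unfolding V_def by blast
        obtain m where m: "0 < m" "E \<subseteq> V \<union> {z. m < norm (P z)}"
        proof (rule compact_zero_set_neighbourhood[OF cE \<open>open V\<close>, of "\<lambda>z. norm (P z)"])
          show "continuous_on UNIV (\<lambda>z. norm (P z))" using contP by (rule continuous_on_norm)
          show "z \<in> V" if "z \<in> E" "norm (P z) = 0" for z
            using that unfolding V_def by (intro subsetD[OF I(2)]) simp
        qed auto
        have "open (V \<union> {z. m < norm (P z)})"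
          using contP \<open>open V\<close> by (intro open_Un open_Collect_less continuous_intros)
        \<comment> \<open>At a late stage of the sequence the rescaled tube lies inside \<open>V\<close>, is thinner than every
          ball of the finite cover, and has exponent above \<open>s\<close>.\<close>
        note ev1 = upper[OF this m(2)]
        have "\<forall>\<^sub>F n in sequentially. s < a n" using order_tendstoD(1)[OF a_lim s(2)] .
        then have ev2: "\<forall>\<^sub>F n in sequentially. s < a (k n)" using k by (rule eventually_subseq[rotated])
        have small: "\<forall>\<^sub>F n in sequentially. r (k n) / \<rho> (k n) < c" if "0 < c" for c
          using order_tendstoD(2)[OF ratio_lim that] k by (rule eventually_subseq[rotated])
        have ev3: "\<forall>\<^sub>F n in sequentially. \<forall>i\<in>I. r (k n) / \<rho> (k n) < 2 * \<delta> i"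
          using I(1) \<delta> by (intro eventually_ball_finite ballI small) auto
        have ev4: "\<forall>\<^sub>F n in sequentially. r (k n) / \<rho> (k n) < m / 2" using m(1) by (intro small) auto
        obtain n where n: "(\<lambda>z. inverse (\<rho> (k n)) *\<^sub>R (z - y (k n))) ` F \<inter> cball 0 1
              \<subseteq> V \<union> {z. m < norm (P z)}"
            "s < a (k n)" "\<forall>i\<in>I. r (k n) / \<rho> (k n) < 2 * \<delta> i" "r (k n) / \<rho> (k n) < m / 2"
          using eventually_happens'[OF sequentially_bot
              eventually_conj[OF ev1 eventually_conj[OF ev2 eventually_conj[OF ev3 ev4]]]] by blast
        have "1 \<le> (\<Sum>i\<in>I. (4 * \<delta> i) powr a (k n))"
        proof (rule frostman_growth_imp_covering_cost_ge_1[OF _ TF(2,3) \<rho> I(1) growth])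
          show "bounded (T (k n))"
            using assms(1) TF(1) by (meson bounded_subset compact_imp_bounded)
          show "0 < \<delta> i \<and> r (k n) \<le> 2 * \<delta> i * \<rho> (k n) \<and> 4 * \<delta> i < 1" if "i \<in> I" for i
          proof -
            have "r (k n) / \<rho> (k n) < 2 * \<delta> i" using n(3) that by blast
            then show ?thesis using \<delta>[of i] \<delta>4[of i] \<rho>[of "k n"] by (simp add: pos_divide_less_eq)
          qed
          show "inverse (\<rho> (k n)) *\<^sub>R (z - y (k n)) \<in> (\<Union>i\<in>I. ball (u i) (\<delta> i))" (is "?x \<in> _")
            if z: "z \<in> T (k n)" "dist (y (k n)) z \<le> \<rho> (k n)" for z
          proof -
            have "norm ?x = dist (y (k n)) z / \<rho> (k n)"
              unfolding norm_scaleR dist_norm norm_minus_commute[of "y (k n)"]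
              using \<rho>[of "k n"] by (simp add: divide_inverse)
            then have "norm ?x \<le> 1" using z(2) \<rho>[of "k n"] by simp
            then have "?x \<in> (\<lambda>z. inverse (\<rho> (k n)) *\<^sub>R (z - y (k n))) ` F \<inter> cball 0 1"
              using z(1) TF(1) by auto
            then have "?x \<in> V \<union> {z. m < norm (P z)}" using n(1) by blast
            moreover have "norm (P ?x) \<le> m"
            proof -
              have "norm (P ?x) = norm (P z - P (y (k n))) / \<rho> (k n)"
                using \<rho>[of "k n"] by (simp add: linear_cmul[OF assms(3)] linear_diff[OF assms(3), symmetric] divide_inverse_commute)
              also have "\<dots> \<le> 2 * r (k n) / \<rho> (k n)"
                using TF(6)[OF z(1)] \<rho>[of "k n"] by (intro divide_right_mono) auto
              also have "\<dots> \<le> m" using n(4) by (simp add: mult.commute)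
              finally show ?thesis .
            qed
            ultimately show ?thesis by (simp add: V_def)
          qed
        qed
        also have "(\<Sum>i\<in>I. (4 * \<delta> i) powr a (k n)) \<le> (\<Sum>i\<in>I. (4 * \<delta> i) powr s)"
          using n(2) \<delta> \<delta>4 by (intro sum_mono powr_mono') (auto simp: less_imp_le)
        also have "\<dots> = 4 powr s * (\<Sum>i\<in>I. \<delta> i powr s)"
          by (simp add: powr_mult sum_distrib_left)
        also have "\<dots> \<le> 4 powr s * e" using cost[OF I(1)] by (intro mult_left_mono) auto
        also have "\<dots> = 1 / 2" by (simp add: e_def powr_divide)
        finally show False by simp
      qed
    qed
  qed
  then show ?thesis using E by (auto simp: d_def)
qed

theorem propositionA:
  fixes F W :: "(real ^ 2) set"
  assumes "compact F" and "F \<noteq> {}"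
    and "subspace W" and "dim W = 1"
  shows "\<exists>E \<in> weak_tangents F. \<exists>x \<in> orth_proj W ` E.
    hausdorff_dim (orth_proj W -` {x} \<inter> E)
      \<ge> max (assouad_dim F - assouad_dim (orth_proj W ` F)) 0"
proof -
  have lin: "linear (orth_proj W)" using assms(3) by (rule linear_orth_proj)
  obtain E where "E \<in> weak_tangents F" "0 \<in> E"
    and dim: "max (assouad_dim F - assouad_dim (orth_proj W ` F)) 0
      \<le> hausdorff_dim (orth_proj W -` {0} \<inter> E)"
    using tangent_with_large_fibre[OF assms(1,2) lin norm_orth_proj_le[OF assms(3)]] by blast
  moreover have "0 \<in> orth_proj W ` E"
    using \<open>0 \<in> E\<close> linear_0[OF lin] by (metis image_eqI)
  ultimately show ?thesis by blast
qed

end
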